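(* Let $q\ge2$ and let $M^q=(M^q_p)_{p\in\mathbb{N}}$ with $M^q_p:=q^{p^2}$. Then for all $c>0$ $$S(H^{\infty}_{v_{M^q,c}}(\mathbb{C}))=H^{\infty}_{v_{M^q,c}}(\mathbb{C})=s(H^{\infty}_{v_{M^q,c}}(\mathbb{C})),$$ so the space $H^{\infty}_{v_{M^q,c}}(\mathbb{C})$ is solid.
   Context: $\mathbb{N}=\{0,1,2,\dots\}$. For a sequence $M=(M_p)_{p\in\mathbb{N}}$ of positive reals with $M_0=1$, the associated weight function is $\omega_M(t):=\sup_{p\in\mathbb{N}}\log(t^p/M_p)$ for $t>0$, $\omega_M(0):=0$. For $c>0$ set $v_{M,c}(r):=\exp(-\omega_M(cr))$, $r\ge0$, and $H^{\infty}_{v_{M,c}}(\mathbb{C}):=\{f \text{ entire}:\ \sup_{z\in\mathbb{C}}|f(z)|v_{M,c}(|z|)<+\infty\}$; an entire function $f(z)=\sum_{j\ge0}a_jz^j$ is identified with its sequence of Taylor coefficients $(a_j)_{j\in\mathbb{N}}$. A vector space $A$ of complex sequences is solid if $(a_j)_j\in A$ and $|b_j|\le|a_j|$ for all $j$ imply $(b_j)_j\in A$. The solid hull is $S(A)=\{(b_j)_j:\exists (a_j)_j\in A,\ |b_j|\le|a_j|\ \forall j\}$ (smallest solid superspace) and the solid core is $s(A)=\{(b_j)_j:(b_j\lambda_j)_j\in A\ \forall(\lambda_j)_j\in\ell^\infty\}$ (largest solid subspace). *)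

theory Defs
  imports "HOL-Complex_Analysis.Complex_Analysis"
begin

text \<open>
  The supremum is the real one, so this is only meaningful if \<open>p \<mapsto> ln (t ^ p / M p)\<close> is bounded
  above for every \<open>t > 0\<close>. For \<open>M p = q ^ p\<^sup>2\<close> this is \<open>bdd_above_q_weight\<close> below.
\<close>

definition assoc_weight :: "(nat \<Rightarrow> real) \<Rightarrow> real \<Rightarrow> real" where
  "assoc_weight M t = (if t = 0 then 0 else (SUP p. ln (t ^ p / M p)))"

definition weight_v :: "(nat \<Rightarrow> real) \<Rightarrow> real \<Rightarrow> real \<Rightarrow> real" where
  "weight_v M c r = exp (- assoc_weight M (c * r))"

definition H_inf :: "(real \<Rightarrow> real) \<Rightarrow> (complex \<Rightarrow> complex) set" where
  "H_inf v = {f. f holomorphic_on UNIV \<and> bdd_above (range (\<lambda>z. norm (f z) * v (norm z)))}"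

definition taylor_coeffs :: "(complex \<Rightarrow> complex) \<Rightarrow> nat \<Rightarrow> complex" where
  "taylor_coeffs f j = (deriv ^^ j) f 0 / fact j"

text \<open>The same space, with entire functions identified with their Taylor coefficients at \<open>0\<close>.\<close>

definition H_inf_seq :: "(real \<Rightarrow> real) \<Rightarrow> (nat \<Rightarrow> complex) set" where
  "H_inf_seq v = taylor_coeffs ` H_inf v"

definition solid :: "(nat \<Rightarrow> complex) set \<Rightarrow> bool" where
  "solid A \<longleftrightarrow> (\<forall>a\<in>A. \<forall>b. (\<forall>j. norm (b j) \<le> norm (a j)) \<longrightarrow> b \<in> A)"

definition solid_hull :: "(nat \<Rightarrow> complex) set \<Rightarrow> (nat \<Rightarrow> complex) set" where
  "solid_hull A = {b. \<exists>a\<in>A. \<forall>j. norm (b j) \<le> norm (a j)}"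

definition solid_core :: "(nat \<Rightarrow> complex) set \<Rightarrow> (nat \<Rightarrow> complex) set" where
  "solid_core A = {b. \<forall>l :: nat \<Rightarrow> complex. bounded (range l) \<longrightarrow> (\<lambda>j. b j * l j) \<in> A}"

lemma bdd_above_q_weight:
  fixes q t :: real
  assumes "q > 1" "t > 0"
  shows "bdd_above (range (\<lambda>p::nat. ln (t ^ p / q ^ (p\<^sup>2))))"
proof (rule bdd_aboveI2)
  fix p :: nat
  have L: "ln q > 0" using assms by simp
  have "0 \<le> (ln t - 2 * real p * ln q)\<^sup>2" by simp
  then have "4 * ln q * (real p * ln t - (real p)\<^sup>2 * ln q) \<le> (ln t)\<^sup>2"
    by (simp add: power2_eq_square algebra_simps)
  moreover have "ln (t ^ p / q ^ (p\<^sup>2)) = real p * ln t - (real p)\<^sup>2 * ln q"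
    using assms by (simp add: ln_div ln_realpow)
  ultimately show "ln (t ^ p / q ^ (p\<^sup>2)) \<le> (ln t)\<^sup>2 / (4 * ln q)"
    using L by (simp add: pos_le_divide_eq mult.commute)
qed

end

theory Submission
  imports Defs
begin

text \<open>
  The space is a weighted \<open>\<ell>\<^sup>\<infinity>\<close>: a sequence \<open>a\<close> belongs to it iff \<open>\<bar>a\<^sub>j\<bar> \<le> K c\<^sup>j / M\<^sub>j\<close> for some
  \<open>K\<close> and all \<open>j\<close> (\<open>H_inf_seq_q_weight\<close>). A condition on the moduli \<open>\<bar>a\<^sub>j\<bar>\<close> that is monotone
  is inherited by smaller sequences, and since \<open>K\<close> is free it survives multiplication by bounded
  sequences; so the solid hull and the solid core both coincide with the space.

  Put \<open>t = c r\<close> and \<open>u\<^sub>j(t) = t\<^sup>j / M\<^sub>j\<close>, so that \<open>exp (\<omega>\<^sub>M t) = sup\<^sub>j u\<^sub>j(t)\<close>.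
  One inclusion is the Cauchy estimate on the circle where \<open>c r = q\<^bsup>2j\<^esup>\<close>: by
  \<open>2jp - p\<^sup>2 \<le> j\<^sup>2\<close> the index \<open>j\<close> is a maximiser of \<open>u\<^sub>p(q\<^bsup>2j\<^esup>)\<close> over \<open>p\<close>, so nothing is
  lost (\<open>H_inf_seq_coeff_le\<close>).
  The other inclusion is where \<open>q\<^bsup>p\<^sup>2\<^esup>\<close> matters. Bounding a power series by the sum of
  the moduli of its terms leaves \<open>\<Sum>\<^sub>j u\<^sub>j(t)\<close>, and this has to be compared with
  \<open>sup\<^sub>j u\<^sub>j(t)\<close> uniformly in \<open>t\<close>. The quotients \<open>u\<^sub>j\<^sub>+\<^sub>1(t) / u\<^sub>j(t) = t q\<^bsup>-2j-1\<^esup>\<close> drop by the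
  fixed factor \<open>q\<^sup>2\<close> at each step, so the terms decay at least geometrically on both sides of the
  largest one, at a rate independent of \<open>t\<close> (\<open>suminf_q_term_le\<close>).
\<close>

section \<open>Weighted spaces of bounded sequences\<close>

definition weighted_linf :: "(nat \<Rightarrow> real) \<Rightarrow> (nat \<Rightarrow> complex) set" where
  "weighted_linf w = {a. \<exists>K. \<forall>j. norm (a j) \<le> K * w j}"

lemma solid_weighted_linf: "solid (weighted_linf w)"
  unfolding solid_def weighted_linf_def by (blast intro: order_trans)

lemma solid_hull_eq_self:
  assumes "solid A"
  shows "solid_hull A = A"
  using assms unfolding solid_def solid_hull_def by blast

lemma solid_core_weighted_linf: "solid_core (weighted_linf w) = weighted_linf w"
proof
  show "solid_core (weighted_linf w) \<subseteq> weighted_linf w"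
  proof
    fix b assume "b \<in> solid_core (weighted_linf w)"
    moreover have "bounded (range (\<lambda>_::nat. 1::complex))" by simp
    ultimately have "(\<lambda>j. b j * 1) \<in> weighted_linf w"
      unfolding solid_core_def by blast
    then show "b \<in> weighted_linf w" by simp
  qed
next
  show "weighted_linf w \<subseteq> solid_core (weighted_linf w)"
  proof
    fix b assume "b \<in> weighted_linf w"
    then obtain K where K: "\<And>j. norm (b j) \<le> K * w j"
      unfolding weighted_linf_def by blast
    have "(\<lambda>j. b j * l j) \<in> weighted_linf w" if "bounded (range l)" for l
    proof -
      obtain L where L: "\<And>j. norm (l j) \<le> L"
        using \<open>bounded (range l)\<close> unfolding bounded_iff by blast
      have "norm (b j * l j) \<le> (K * L) * w j" for j
      proof -
        have "norm (b j * l j) \<le> (K * w j) * L"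
          unfolding norm_mult
          by (rule mult_mono[OF K L]) (use order_trans[OF norm_ge_zero K] in auto)
        then show ?thesis by (simp add: mult_ac)
      qed
      then show ?thesis unfolding weighted_linf_def by blast
    qed
    then show "b \<in> solid_core (weighted_linf w)"
      unfolding solid_core_def by blast
  qed
qed

section \<open>Coefficient estimates for entire functions of weighted growth\<close>

lemma H_inf_seq_cauchy_bound:
  assumes "a \<in> H_inf_seq v"
  obtains B where "\<And>j r. r > 0 \<Longrightarrow> v r > 0 \<Longrightarrow> norm (a j) \<le> B / (v r * r ^ j)"
proof -
  obtain f where f: "f holomorphic_on UNIV" "bdd_above (range (\<lambda>z. norm (f z) * v (norm z)))"
    and a: "a = taylor_coeffs f"
    using assms unfolding H_inf_seq_def H_inf_def by blast
  obtain B where B: "\<And>z. norm (f z) * v (norm z) \<le> B"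
    using f(2) by (auto simp: bdd_above_def)
  have "norm (a j) \<le> B / (v r * r ^ j)" if r: "r > 0" "v r > 0" for j r
  proof -
    have "norm ((deriv ^^ j) f 0) \<le> fact j * (B / v r) / r ^ j"
    proof (rule Cauchy_inequality)
      show "f holomorphic_on ball 0 r" "continuous_on (cball 0 r) f"
        using f(1) holomorphic_on_subset holomorphic_on_imp_continuous_on by blast+
      show "norm (f z) \<le> B / v r" if "norm (0 - z) = r" for z
        using B[of z] that r by (simp add: pos_le_divide_eq)
    qed (use r in auto)
    then have "norm ((deriv ^^ j) f 0) / fact j \<le> fact j * (B / v r) / r ^ j / fact j"
      by (rule divide_right_mono) simp
    then show ?thesis
      by (simp add: a taylor_coeffs_def norm_divide)
  qed
  then show thesis by (rule that)
qed

lemma H_inf_seq_of_summable_bound: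
  assumes summ: "\<And>r. r \<ge> 0 \<Longrightarrow> summable (\<lambda>j. norm (a j) * r ^ j)"
    and bound: "\<And>r. r \<ge> 0 \<Longrightarrow> (\<Sum>j. norm (a j) * r ^ j) * v r \<le> B"
    and v: "\<And>r. r \<ge> 0 \<Longrightarrow> v r \<ge> 0"
  shows "a \<in> H_inf_seq v"
proof -
  define F where "F = Abs_fps a"
  have summ': "summable (\<lambda>j. norm (a j * z ^ j))" for z
    using summ[of "norm z"] by (simp add: norm_mult norm_power)
  have rad: "fps_conv_radius F = \<infinity>"
    unfolding fps_conv_radius_def F_def
    by (rule conv_radius_inftyI'') (auto intro: summable_norm_cancel[OF summ'])
  have "eval_fps F holomorphic_on UNIV"
    by (rule holomorphic_on_eval_fps) (simp add: rad)
  moreover have "norm (eval_fps F z) * v (norm z) \<le> B" for z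
  proof -
    have "norm (eval_fps F z) \<le> (\<Sum>j. norm (a j * z ^ j))"
      unfolding eval_fps_def F_def by (simp add: summable_norm[OF summ'])
    then have "norm (eval_fps F z) * v (norm z) \<le> (\<Sum>j. norm (a j * z ^ j)) * v (norm z)"
      by (rule mult_right_mono) (simp add: v)
    also have "\<dots> \<le> B"
      using bound[of "norm z"] by (simp add: norm_mult norm_power)
    finally show ?thesis .
  qed
  moreover have "taylor_coeffs (eval_fps F) = a"
    using fps_nth_conv_deriv[of F] rad by (auto simp: taylor_coeffs_def F_def fun_eq_iff)
  ultimately show ?thesis
    unfolding H_inf_seq_def H_inf_def by (auto intro!: bdd_aboveI2 image_eqI[where x = "eval_fps F"])
qed

section \<open>The terms of the weight function\<close>

definition q_term :: "real \<Rightarrow> real \<Rightarrow> nat \<Rightarrow> real" where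
  "q_term q t p = t ^ p / q ^ (p\<^sup>2)"

lemma two_mult_le_sum_squares: "2 * j * p \<le> j\<^sup>2 + p\<^sup>2" for j p :: nat
proof -
  have "real (2 * j * p) \<le> real (j\<^sup>2 + p\<^sup>2)"
    using sum_squares_bound[of "real j" "real p"] by simp
  then show ?thesis by (simp only: of_nat_le_iff)
qed

lemma q_term_nonneg: "q > 1 \<Longrightarrow> t \<ge> 0 \<Longrightarrow> q_term q t p \<ge> 0"
  by (simp add: q_term_def)

lemma q_term_shift:
  assumes "q > 1"
  shows "q_term q t (m + k) = q_term q t m * (t / q ^ (2 * m)) ^ k / q ^ (k\<^sup>2)"
proof -
  have "(m + k)\<^sup>2 = m\<^sup>2 + 2 * m * k + k\<^sup>2"
    by (simp add: power2_eq_square algebra_simps)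
  then show ?thesis
    using assms by (simp add: q_term_def power_add power_mult power_divide)
qed

text \<open>
  For \<open>t > 0\<close> the right-hand side is the supremum of the terms. At \<open>t = 0\<close> it is \<open>1\<close> by
  convention, which is also the only nonzero term, the one of index \<open>0\<close>.
\<close>

lemma q_term_le_exp_assoc_weight:
  assumes "q > 1" "t \<ge> 0"
  shows "q_term q t p \<le> exp (assoc_weight (\<lambda>p. q ^ (p\<^sup>2)) t)"
proof (cases "t = 0")
  case True
  then show ?thesis by (cases p) (auto simp: q_term_def assoc_weight_def)
next
  case False
  then have t: "t > 0" using assms by simp
  have "ln (q_term q t p) \<le> assoc_weight (\<lambda>p. q ^ (p\<^sup>2)) t"
    unfolding q_term_def assoc_weight_def using False
    by (auto intro!: cSUP_upper bdd_above_q_weight assms t)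
  then have "exp (ln (q_term q t p)) \<le> exp (assoc_weight (\<lambda>p. q ^ (p\<^sup>2)) t)"
    by simp
  moreover have "q_term q t p > 0" using t assms by (simp add: q_term_def)
  ultimately show ?thesis by simp
qed

text \<open>The exponent \<open>2jp - p\<^sup>2\<close> of \<open>q\<close> in the term of index \<open>p\<close> is at most \<open>j\<^sup>2\<close>.\<close>

lemma exp_assoc_weight_le:
  assumes "q > 1"
  shows "exp (assoc_weight (\<lambda>p. q ^ (p\<^sup>2)) (q ^ (2 * j))) \<le> q ^ (j\<^sup>2)"
proof -
  have "ln ((q ^ (2 * j)) ^ p / q ^ (p\<^sup>2)) \<le> ln (q ^ (j\<^sup>2))" for p
  proof -
    have "(q ^ (2 * j)) ^ p \<le> q ^ (j\<^sup>2) * q ^ (p\<^sup>2)"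
      using assms two_mult_le_sum_squares[of j p] by (simp flip: power_mult power_add)
    then have "(q ^ (2 * j)) ^ p / q ^ (p\<^sup>2) \<le> q ^ (j\<^sup>2)"
      using assms by (simp add: pos_divide_le_eq)
    then show ?thesis using assms by (subst ln_le_cancel_iff) auto
  qed
  then have "assoc_weight (\<lambda>p. q ^ (p\<^sup>2)) (q ^ (2 * j)) \<le> ln (q ^ (j\<^sup>2))"
    using assms by (auto simp: assoc_weight_def intro!: cSUP_least)
  then have "exp (assoc_weight (\<lambda>p. q ^ (p\<^sup>2)) (q ^ (2 * j))) \<le> exp (ln (q ^ (j\<^sup>2)))"
    by simp
  then show ?thesis using assms by simp
qed

section \<open>The sum of the terms is comparable to the largest term\<close>

lemma two_sided_geometric_suminf_le:
  fixes u :: "nat \<Rightarrow> real"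
  assumes nonneg: "\<And>j. u j \<ge> 0" and x: "0 \<le> x" "x < 1"
    and right: "\<And>k. u (m + k) \<le> B * x ^ k"
    and left: "\<And>k. k \<le> m \<Longrightarrow> u (m - k) \<le> B * x ^ k"
  shows "summable u" "suminf u \<le> 2 * B / (1 - x)"
proof -
  have geo: "summable (\<lambda>k. B * x ^ k)" "(\<Sum>k. B * x ^ k) = B / (1 - x)"
    using x by (auto intro!: summable_mult summable_geometric simp: suminf_mult suminf_geometric)
  have B: "B \<ge> 0" using order_trans[OF nonneg right[of 0]] by simp
  have tail: "summable (\<lambda>k. u (k + m))"
    by (rule summable_comparison_test'[OF geo(1), of 0])
       (use nonneg right in \<open>auto simp: add.commute\<close>)
  then show S: "summable u" by (simp add: summable_iff_shift)
  have "(\<Sum>k. u (k + m)) \<le> (\<Sum>k. B * x ^ k)"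
    by (rule suminf_le[OF _ tail geo(1)]) (use right in \<open>auto simp: add.commute\<close>)
  moreover have "(\<Sum>j<m. u j) \<le> (\<Sum>k. B * x ^ k)"
  proof -
    have "(\<Sum>j<m. u j) = (\<Sum>k<m. u (m - Suc k))"
      by (rule sum.nat_diff_reindex[symmetric])
    also have "\<dots> \<le> (\<Sum>k<m. B * x ^ k)"
    proof (rule sum_mono)
      fix k assume "k \<in> {..<m}"
      then have "u (m - Suc k) \<le> B * x ^ Suc k" by (intro left) auto
      also have "\<dots> \<le> B * x ^ k" using x B by (auto intro!: mult_left_mono mult_left_le_one_le)
      finally show "u (m - Suc k) \<le> B * x ^ k" .
    qed
    also have "\<dots> \<le> (\<Sum>k. B * x ^ k)"
      by (rule sum_le_suminf[OF geo(1)]) (use x B in auto)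
    finally show ?thesis .
  qed
  ultimately show "suminf u \<le> 2 * B / (1 - x)"
    using suminf_split_initial_segment[OF S, of m] geo(2) by simp
qed

text \<open>
  The largest term has the index \<open>m\<close> at which the quotients \<open>t q\<^bsup>-2m-1\<^esup>\<close> of successive terms
  first fall to \<open>1\<close> or below. At distance \<open>k\<close> from it the terms have dropped by the factor
  \<open>q\<^bsup>k - k\<^sup>2\<^esup> \<le> q \<cdot> q\<^bsup>-k\<^esup>\<close>.
\<close>

lemma q_term_geometric_decay:
  assumes q: "q > 1" and t: "t \<ge> 0"
  obtains m where
    "\<And>k. q_term q t (m + k) \<le> q * q_term q t m * (1 / q) ^ k"
    "\<And>k. k \<le> m \<Longrightarrow> q_term q t (m - k) \<le> q * q_term q t m * (1 / q) ^ k"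
proof -
  have "\<exists>n. t \<le> q ^ (2 * n + 1)"
  proof -
    obtain n where "t < q ^ n" using real_arch_pow[OF q] by blast
    also have "q ^ n \<le> q ^ (2 * n + 1)" using q by (intro power_increasing) auto
    finally show ?thesis by (blast intro: less_imp_le)
  qed
  then obtain m where m: "t \<le> q ^ (2 * m + 1)" "\<And>n. n < m \<Longrightarrow> q ^ (2 * n + 1) < t"
    using exists_least_iff[of "\<lambda>n. t \<le> q ^ (2 * n + 1)"] by (auto simp: not_le)
  note nn = q_term_nonneg[OF q t]
  have decay: "q_term q t m * q ^ k / q ^ (k\<^sup>2) \<le> q * q_term q t m * (1 / q) ^ k" for k
  proof -
    have "2 * k \<le> k\<^sup>2 + 1"
      using two_mult_le_sum_squares[of k 1] by simp
    then have "q ^ (2 * k) \<le> q ^ (k\<^sup>2 + 1)"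
      using q by (intro power_increasing) auto
    then have "q ^ k / q ^ (k\<^sup>2) \<le> q * (1 / q) ^ k"
      using q by (simp only: mult_2 power_add) (simp add: field_simps)
    from mult_left_mono[OF this nn, of m] show ?thesis by (simp add: mult_ac)
  qed
  show thesis
  proof (rule that)
    fix k
    have "t / q ^ (2 * m) \<le> q"
      using m(1) q by (simp add: pos_divide_le_eq)
    then have "(t / q ^ (2 * m)) ^ k \<le> q ^ k"
      using q t by (intro power_mono) auto
    then have "q_term q t (m + k) \<le> q_term q t m * q ^ k / q ^ (k\<^sup>2)"
      unfolding q_term_shift[OF q] using q nn by (intro divide_right_mono mult_left_mono) auto
    with decay[of k] show "q_term q t (m + k) \<le> q * q_term q t m * (1 / q) ^ k"
      by linarith
  next
    fix k assume k: "k \<le> m"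
    show "q_term q t (m - k) \<le> q * q_term q t m * (1 / q) ^ k"
    proof (cases "k = 0")
      case True
      then show ?thesis using decay[of 0] by simp
    next
      case False
      define j where "j = m - k"
      have mjk: "m = j + k" using k by (simp add: j_def)
      \<comment> \<open>Reading the shift formula from \<open>j\<close> up to \<open>m\<close>, a lower bound for \<open>t\<close> makes the term
        of index \<open>j\<close> small; minimality of \<open>m\<close> supplies that bound.\<close>
      have "q ^ (2 * (m - 1) + 1) < t" using m(2)[of "m - 1"] mjk False by simp
      moreover have "2 * (m - 1) + 1 = 2 * j + (2 * k - 1)" using mjk False by simp
      ultimately have "q ^ (2 * j) * q ^ (2 * k - 1) < t" by (simp only: power_add)
      then have "q ^ (2 * k - 1) \<le> t / q ^ (2 * j)"
        using q by (simp add: pos_le_divide_eq mult.commute)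
      then have "(q ^ (2 * k - 1)) ^ k \<le> (t / q ^ (2 * j)) ^ k"
        using q by (intro power_mono) auto
      moreover have "(q ^ (2 * k - 1)) ^ k * q ^ k = q ^ (k\<^sup>2) * q ^ (k\<^sup>2)"
      proof -
        have "(2 * k - 1) * k + k = k\<^sup>2 + k\<^sup>2"
          using False by (cases k) (simp_all add: power2_eq_square algebra_simps)
        then show ?thesis by (simp only: flip: power_mult power_add)
      qed
      ultimately have "q ^ (k\<^sup>2) * q ^ (k\<^sup>2) \<le> (t / q ^ (2 * j)) ^ k * q ^ k"
        using q by (metis mult_right_mono zero_le_power less_imp_le zero_less_one order_less_trans)
      then have "1 \<le> (t / q ^ (2 * j)) ^ k / q ^ (k\<^sup>2) * (q ^ k / q ^ (k\<^sup>2))"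
        using q by (simp add: pos_le_divide_eq mult_ac)
      from mult_left_mono[OF this nn, of j]
      have "q_term q t j \<le> q_term q t m * q ^ k / q ^ (k\<^sup>2)"
        unfolding mjk q_term_shift[OF q] by (simp add: mult_ac)
      with decay[of k] show ?thesis unfolding j_def by linarith
    qed
  qed
qed

lemma suminf_q_term_le:
  assumes q: "q > 1" and t: "t \<ge> 0"
  shows "summable (q_term q t)"
    and "suminf (q_term q t) \<le> 2 * q / (1 - 1 / q) * exp (assoc_weight (\<lambda>p. q ^ (p\<^sup>2)) t)"
proof -
  obtain m where m:
    "\<And>k. q_term q t (m + k) \<le> q * q_term q t m * (1 / q) ^ k"
    "\<And>k. k \<le> m \<Longrightarrow> q_term q t (m - k) \<le> q * q_term q t m * (1 / q) ^ k"
    using q_term_geometric_decay[OF q t] by blast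
  have x: "0 \<le> 1 / q" "1 / q < 1" using q by auto
  note geo = two_sided_geometric_suminf_le[OF q_term_nonneg[OF q t] x m]
  show "summable (q_term q t)" by (rule geo(1))
  have "suminf (q_term q t) \<le> 2 * q / (1 - 1 / q) * q_term q t m"
    using geo(2) by (simp add: mult_ac)
  also have "\<dots> \<le> 2 * q / (1 - 1 / q) * exp (assoc_weight (\<lambda>p. q ^ (p\<^sup>2)) t)"
    using q by (intro mult_left_mono q_term_le_exp_assoc_weight t) auto
  finally show "suminf (q_term q t) \<le> \<dots>" .
qed

section \<open>The space as a weighted space of bounded sequences\<close>

lemma H_inf_seq_coeff_le:
  assumes q: "q > 1" and c: "c > 0"
    and a: "a \<in> H_inf_seq (weight_v (\<lambda>p. q ^ (p\<^sup>2)) c)"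
  shows "a \<in> weighted_linf (q_term q c)"
proof -
  let ?v = "weight_v (\<lambda>p. q ^ (p\<^sup>2)) c"
  obtain B where B: "\<And>j r. r > 0 \<Longrightarrow> ?v r > 0 \<Longrightarrow> norm (a j) \<le> B / (?v r * r ^ j)"
    using H_inf_seq_cauchy_bound[OF a] by blast
  have vpos: "?v r > 0" for r by (simp add: weight_v_def)
  have "0 \<le> B / (?v 1 * 1 ^ 0)"
    using order_trans[OF norm_ge_zero B[of 1 0]] vpos by simp
  then have B0: "B \<ge> 0" using vpos[of 1] by (simp add: zero_le_divide_iff)
  have "norm (a j) \<le> B * q_term q c j" for j
  proof -
    \<comment> \<open>The radius at which the \<open>j\<close>-th term is the largest, hence the optimal Cauchy estimate.\<close>
    define r where "r = q ^ (2 * j) / c"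
    have r: "r > 0" "c * r = q ^ (2 * j)" using q c by (auto simp: r_def)
    have "norm (a j) \<le> B / (?v r * r ^ j)" by (rule B[OF r(1) vpos])
    also have "\<dots> = B * exp (assoc_weight (\<lambda>p. q ^ (p\<^sup>2)) (q ^ (2 * j))) / r ^ j"
      by (simp add: weight_v_def r(2) exp_minus field_simps)
    also have "\<dots> \<le> B * q ^ (j\<^sup>2) / r ^ j"
      using r B0 exp_assoc_weight_le[OF q, of j] by (intro divide_right_mono mult_left_mono) auto
    also have "\<dots> = B * q_term q c j"
    proof -
      have "(q ^ (2 * j)) ^ j = q ^ (j\<^sup>2) * q ^ (j\<^sup>2)"
        by (simp flip: power_mult power_add add: power2_eq_square mult_2 distrib_right)
      then show ?thesis using q c by (simp add: r_def q_term_def power_divide)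
    qed
    finally show ?thesis .
  qed
  then show ?thesis unfolding weighted_linf_def by blast
qed

lemma H_inf_seq_q_weight:
  assumes q: "q > 1" and c: "c > 0"
  shows "H_inf_seq (weight_v (\<lambda>p. q ^ (p\<^sup>2)) c) = weighted_linf (q_term q c)"
proof (intro equalityI subsetI H_inf_seq_coeff_le[OF q c])
  fix a assume "a \<in> weighted_linf (q_term q c)"
  then obtain K where K: "\<And>j. norm (a j) \<le> K * q_term q c j"
    unfolding weighted_linf_def by blast
  have K0: "K \<ge> 0"
    using order_trans[OF norm_ge_zero K[of 0]] by (simp add: q_term_def)
  have le: "norm (a j) * r ^ j \<le> K * q_term q (c * r) j" if "r \<ge> 0" for r j
    using mult_right_mono[OF K[of j], of "r ^ j"] that
    by (simp add: q_term_def power_mult_distrib)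
  show "a \<in> H_inf_seq (weight_v (\<lambda>p. q ^ (p\<^sup>2)) c)"
  proof (rule H_inf_seq_of_summable_bound)
    fix r :: real assume r: "r \<ge> 0"
    then have t: "c * r \<ge> 0" using c by simp
    let ?E = "exp (assoc_weight (\<lambda>p. q ^ (p\<^sup>2)) (c * r))"
    note u = suminf_q_term_le[OF q t]
    have uK: "summable (\<lambda>j. K * q_term q (c * r) j)" by (rule summable_mult[OF u(1)])
    show s: "summable (\<lambda>j. norm (a j) * r ^ j)"
      by (rule summable_comparison_test'[OF uK, of 0]) (use le[OF r] r in auto)
    have "(\<Sum>j. norm (a j) * r ^ j) \<le> (\<Sum>j. K * q_term q (c * r) j)"
      by (rule suminf_le[OF le[OF r] s uK])
    also have "\<dots> = K * suminf (q_term q (c * r))" by (rule suminf_mult[OF u(1)])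
    also have "\<dots> \<le> K * (2 * q / (1 - 1 / q) * ?E)"
      by (rule mult_left_mono[OF u(2) K0])
    finally have "(\<Sum>j. norm (a j) * r ^ j) * exp (- assoc_weight (\<lambda>p. q ^ (p\<^sup>2)) (c * r))
        \<le> K * (2 * q / (1 - 1 / q) * ?E) * exp (- assoc_weight (\<lambda>p. q ^ (p\<^sup>2)) (c * r))"
      by (rule mult_right_mono) simp
    then show "(\<Sum>j. norm (a j) * r ^ j) * weight_v (\<lambda>p. q ^ (p\<^sup>2)) c r
        \<le> K * (2 * q / (1 - 1 / q))"
      by (simp add: weight_v_def mult.assoc flip: exp_add)
  qed (simp add: weight_v_def)
qed

theorem corollary4p16:
  fixes q c :: real and M :: "nat \<Rightarrow> real"
  assumes "q \<ge> 2" and "\<And>p. M p = q ^ (p\<^sup>2)" and "c > 0"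
  shows "solid_hull (H_inf_seq (weight_v M c)) = H_inf_seq (weight_v M c) \<and>
         H_inf_seq (weight_v M c) = solid_core (H_inf_seq (weight_v M c)) \<and>
         solid (H_inf_seq (weight_v M c))"
proof -
  have "M = (\<lambda>p. q ^ (p\<^sup>2))" using assms(2) by (rule ext)
  moreover have "q > 1" using assms(1) by simp
  ultimately have "H_inf_seq (weight_v M c) = weighted_linf (q_term q c)"
    using assms(3) by (simp add: H_inf_seq_q_weight)
  then show ?thesis
    by (simp add: solid_hull_eq_self solid_weighted_linf solid_core_weighted_linf)
qed

end
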